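(* Let $r\ge 1$ be an integer and $\lambda_r\in\mathbb{R}$ with $\lambda_r>0$, $\lambda_r\ne1$. Let ${\mathcal D}^{d(n)}(\lambda_r;r)$ be the union of the Gershgorin intervals of the $n\times n$ Jacobi matrix of $\{P^d_k(\lambda_r;r)\}_{k\ge0}$. Then: \begin{enumerate} \item For $r=1$: if $\lambda_1>0$, then ${\mathcal D}^{d(3)}(\lambda_1;1)=\big[-\frac{1+\sqrt{\lambda_1}}{2},\frac{1+\sqrt{\lambda_1}}{2}\big]$; if $0<\lambda_1<1$, then ${\mathcal D}^{d(n)}(\lambda_1;1)=[-1,1]$ for $n\ge4$; if $\lambda_1>1$, then ${\mathcal D}^{d(n)}(\lambda_1;1)=\big[-\frac{1+\sqrt{\lambda_1}}{2},\frac{1+\sqrt{\lambda_1}}{2}\big]$ for $n\ge4$. \item For $r=2$: if $\lambda_2>0$, then ${\mathcal D}^{d(3)}(\lambda_2;2)={\mathcal D}^{d(4)}(\lambda_2;2)=\big[-\frac{1+\sqrt{\lambda_2}}{2},\frac{1+\sqrt{\lambda_2}}{2}\big]$; if $0<\lambda_2<1$, then ${\mathcal D}^{d(n)}(\lambda_2;2)=[-1,1]$ for $n\ge5$; if $\lambda_2>1$, then ${\mathcal D}^{d(n)}(\lambda_2;2)=\big[-\frac{1+\sqrt{\lambda_2}}{2},\frac{1+\sqrt{\lambda_2}}{2}\big]$ for $n\ge5$. \item For $r\ge3$: if $0<\lambda_r<1$, then ${\mathcal D}^{d(n)}(\lambda_r;r)=[-1,1]$ for $n\ge r+1$; if $\lambda_r>1$,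 then ${\mathcal D}^{d(n)}(\lambda_r;r)=\big[-\frac{1+\sqrt{\lambda_r}}{2},\frac{1+\sqrt{\lambda_r}}{2}\big]$ for $n\ge r+1$. \end{enumerate}
   Context: For an integer $r\ge 1$ and $\lambda_r>0$, $\lambda_r\ne1$, the $r$th-perturbed by dilatation sequence $\{P^d_n(\lambda_r;r)\}_{n\ge 0}$ of the monic Chebyshev polynomials of the second kind is the monic sequence with $P^d_0=1$, $P^d_1(x)=x$, $P^d_{n+2}(x)=xP^d_{n+1}(x)-\gamma_{n+1}P^d_n(x)$ for $n\ge 0$, where $\gamma_r=\lambda_r/4$ and $\gamma_{n+1}=1/4$ for $n\ge 0$, $n\ne r-1$. Its $n\times n$ Jacobi matrix is the real symmetric tridiagonal matrix with zero diagonal and with entries $\sqrt{\gamma_1},\dots,\sqrt{\gamma_{n-1}}$ on the sub- and super-diagonal (so all equal to $\frac12$ except the entries in positions $(r,r+1)$ and $(r+1,r)$, which equal $\frac{\sqrt{\lambda_r}}2$); $P^d_n(\lambda_r;r)$ is its characteristic polynomial. For a real symmetric matrix $A=(a_{ij})_{1\le i,j\le n}$ the Gershgorin intervals are $[a_{ii}-\rho_i,a_{ii}+\rho_i]$, $1\le i\le n$, with $\rho_i=\sum_{j\ne i}|a_{ij}|$. *)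

theory Defs
  imports "HOL-Analysis.Analysis" "Jordan_Normal_Form.Char_Poly"
begin

text \<open>Monic sequences given by
  \<open>P\<^sub>0 = 1\<close>, \<open>P\<^sub>1 = x\<close>, \<open>P\<^sub>n\<^sub>+\<^sub>2 = x P\<^sub>n\<^sub>+\<^sub>1 - \<gamma>\<^sub>n\<^sub>+\<^sub>1 P\<^sub>n\<close>.
  The recurrence coefficients are indexed from 1; the value \<open>\<gamma> 0\<close> is never used.\<close>

fun monic_rec_poly :: "(nat \<Rightarrow> real) \<Rightarrow> nat \<Rightarrow> real poly" where
  "monic_rec_poly \<gamma> 0 = 1"
| "monic_rec_poly \<gamma> (Suc 0) = [:0, 1:]"
| "monic_rec_poly \<gamma> (Suc (Suc n)) =
     [:0, 1:] * monic_rec_poly \<gamma> (Suc n) - Polynomial.smult (\<gamma> (Suc n)) (monic_rec_poly \<gamma> n)"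

text \<open>Matrix indices start at 0, so entry \<open>(i, i + 1)\<close> below is the entry in position
  \<open>(i + 1, i + 2)\<close> of the usual 1-based convention, namely \<open>sqrt \<gamma>\<^sub>i\<^sub>+\<^sub>1\<close>.\<close>

definition jacobi_matrix :: "(nat \<Rightarrow> real) \<Rightarrow> nat \<Rightarrow> real mat" where
  "jacobi_matrix \<gamma> n = mat n n (\<lambda>(i, j).
     if j = i + 1 then sqrt (\<gamma> (i + 1))
     else if i = j + 1 then sqrt (\<gamma> (j + 1))
     else 0)"

definition dilated_gamma :: "real \<Rightarrow> nat \<Rightarrow> nat \<Rightarrow> real" where
  "dilated_gamma lam r k = (if k = r then lam / 4 else 1 / 4)"

text \<open>The monic Chebyshev polynomials of the second kind, with the \<open>r\<close>th recurrence coefficient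
  perturbed by dilatation.\<close>

definition dilated_chebyshev :: "real \<Rightarrow> nat \<Rightarrow> nat \<Rightarrow> real poly" where
  "dilated_chebyshev lam r = monic_rec_poly (dilated_gamma lam r)"

definition dilated_jacobi :: "real \<Rightarrow> nat \<Rightarrow> nat \<Rightarrow> real mat" where
  "dilated_jacobi lam r n = jacobi_matrix (dilated_gamma lam r) n"

definition gershgorin_radius :: "real mat \<Rightarrow> nat \<Rightarrow> real" where
  "gershgorin_radius A i = (\<Sum>j \<in> {..<dim_col A} - {i}. \<bar>A $$ (i, j)\<bar>)"

definition gershgorin_interval :: "real mat \<Rightarrow> nat \<Rightarrow> real set" where
  "gershgorin_interval A i =
     {A $$ (i, i) - gershgorin_radius A i .. A $$ (i, i) + gershgorin_radius A i}"

definition gershgorin_union :: "real mat \<Rightarrow> real set" where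
  "gershgorin_union A = (\<Union>i<dim_row A. gershgorin_interval A i)"

definition gershgorin_dilated :: "nat \<Rightarrow> real \<Rightarrow> nat \<Rightarrow> real set" where
  "gershgorin_dilated n lam r = gershgorin_union (dilated_jacobi lam r n)"

lemma jacobi_matrix_carrier [simp]: "jacobi_matrix \<gamma> n \<in> carrier_mat n n"
  by (simp add: jacobi_matrix_def)

lemma dim_jacobi_matrix [simp]:
  "dim_row (jacobi_matrix \<gamma> n) = n" "dim_col (jacobi_matrix \<gamma> n) = n"
  by (simp_all add: jacobi_matrix_def)

lemma char_poly_matrix_jacobi:
  "char_poly_matrix (jacobi_matrix \<gamma> n) = mat n n (\<lambda>(i, j).
     if i = j then [:0, 1:]
     else if j = i + 1 then [:- sqrt (\<gamma> (i + 1)):]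
     else if i = j + 1 then [:- sqrt (\<gamma> (j + 1)):]
     else 0)"
  by (rule eq_matI) (auto simp: char_poly_matrix_def jacobi_matrix_def)

lemma char_poly_jacobi_rec:
  assumes "0 \<le> \<gamma> (Suc n)"
  shows "char_poly (jacobi_matrix \<gamma> (Suc (Suc n))) =
    [:0, 1:] * char_poly (jacobi_matrix \<gamma> (Suc n))
      - Polynomial.smult (\<gamma> (Suc n)) (char_poly (jacobi_matrix \<gamma> n))"
proof -
  define M where "M k = char_poly_matrix (jacobi_matrix \<gamma> k)" for k
  note M = M_def char_poly_matrix_jacobi
  define a where "a = [:- sqrt (\<gamma> (Suc n)):]"
  define B where "B = mat_delete (M (Suc (Suc n))) (Suc n) n"
  have dimB: "B \<in> carrier_mat (Suc n) (Suc n)"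
    by (simp add: B_def M mat_delete_def)
  have delA: "mat_delete (M (Suc (Suc n))) (Suc n) (Suc n) = M (Suc n)"
    by (rule eq_matI) (auto simp: M mat_delete_def)
  have delB: "mat_delete B n n = M n"
    by (rule eq_matI) (auto simp: B_def M mat_delete_def)
  have "det B = (\<Sum>i<Suc n. B $$ (i, n) * cofactor B i n)"
    by (rule laplace_expansion_column[OF dimB]) simp
  also have "\<dots> = B $$ (n, n) * cofactor B n n"
    by (subst sum.remove[of _ n]) (auto simp: B_def M mat_delete_def intro!: sum.neutral)
  also have "\<dots> = a * det (M n)"
    by (simp add: cofactor_def delB) (simp add: B_def M mat_delete_def a_def)
  finally have detB: "det B = a * det (M n)" .
  have "det (M (Suc (Suc n))) =
      (\<Sum>j<Suc (Suc n). M (Suc (Suc n)) $$ (Suc n, j) * cofactor (M (Suc (Suc n))) (Suc n) j)"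
    by (rule laplace_expansion_row) (auto simp: M)
  also have "\<dots> = (\<Sum>j<n. M (Suc (Suc n)) $$ (Suc n, j) * cofactor (M (Suc (Suc n))) (Suc n) j)
      + a * cofactor (M (Suc (Suc n))) (Suc n) n
      + [:0, 1:] * cofactor (M (Suc (Suc n))) (Suc n) (Suc n)"
    by (simp add: M a_def)
  also have "(\<Sum>j<n. M (Suc (Suc n)) $$ (Suc n, j) * cofactor (M (Suc (Suc n))) (Suc n) j) = 0"
    by (rule sum.neutral) (auto simp: M)
  also have "cofactor (M (Suc (Suc n))) (Suc n) n = - det B"
    by (simp add: cofactor_def B_def)
  also have "cofactor (M (Suc (Suc n))) (Suc n) (Suc n) = det (M (Suc n))"
    by (simp add: cofactor_def delA)
  finally have "det (M (Suc (Suc n))) = [:0, 1:] * det (M (Suc n)) - (a * a) * det (M n)"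
    by (simp add: detB algebra_simps)
  moreover have "a * a = [:\<gamma> (Suc n):]"
    using assms by (simp add: a_def)
  ultimately show ?thesis
    by (simp add: char_poly_def M_def)
qed

lemma char_poly_jacobi_matrix:
  assumes "\<And>k. 0 \<le> \<gamma> k"
  shows "char_poly (jacobi_matrix \<gamma> n) = monic_rec_poly \<gamma> n"
proof (induction n rule: induct_nat_012)
  case 0
  show ?case by (simp add: char_poly_def)
next
  case 1
  show ?case by (simp add: char_poly_def char_poly_matrix_jacobi det_single)
next
  case (ge2 n)
  then show ?case using assms by (simp add: char_poly_jacobi_rec)
qed

lemma char_poly_dilated_jacobi:
  assumes "lam > 0"
  shows "char_poly (dilated_jacobi lam r n) = dilated_chebyshev lam r n"
  unfolding dilated_jacobi_def dilated_chebyshev_def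
  by (rule char_poly_jacobi_matrix) (use assms in \<open>simp add: dilated_gamma_def\<close>)

end

theory Submission
  imports Defs
begin

text \<open>The diagonal is zero, so the Gershgorin intervals are all centred at 0, hence nested,
  and their union is the one of largest radius (\<open>gershgorin_union_zero_diagonal\<close>). A
  radius is a sum of at most two off-diagonal entries: at most 1/2 or \<open>sqrt lam / 2\<close> in
  an end row, 1 in an inner row away from the perturbed entry, and \<open>(1 + sqrt lam) / 2\<close>
  in an inner row next to it. For \<open>lam > 1\<close> the last value wins. For
  \<open>lam < 1\<close> the value 1 wins as soon as some inner row avoids the perturbation, and the
  bounds on \<open>n\<close> ensure this. In the three smallest cases no inner row avoids it, so
  \<open>(1 + sqrt lam) / 2\<close> is the maximum for every \<open>lam\<close>.\<close>

lemma gershgorin_radius_jacobi: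
  assumes "i < n" and "\<And>k. 0 \<le> \<gamma> k"
  shows "gershgorin_radius (jacobi_matrix \<gamma> n) i =
    (if i = 0 then 0 else sqrt (\<gamma> i)) + (if i + 1 < n then sqrt (\<gamma> (i + 1)) else 0)"
proof -
  \<comment> \<open>The left neighbour is tested by \<open>j + 1 = i\<close> because truncated
    subtraction would misplace it for \<open>i = 0\<close>.\<close>
  have "gershgorin_radius (jacobi_matrix \<gamma> n) i =
      (\<Sum>j\<in>{..<n} - {i}. (if j + 1 = i then sqrt (\<gamma> i) else 0) +
        (if j = i + 1 then sqrt (\<gamma> (i + 1)) else 0))"
    unfolding gershgorin_radius_def using assms
    by (intro sum.cong) (auto simp: jacobi_matrix_def)
  also have "\<dots> = (\<Sum>j\<in>{..<n} - {i}. if j + 1 = i then sqrt (\<gamma> i) else 0) +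
      (\<Sum>j\<in>{..<n} - {i}. if j = i + 1 then sqrt (\<gamma> (i + 1)) else 0)"
    by (rule sum.distrib)
  also have "(\<Sum>j\<in>{..<n} - {i}. if j + 1 = i then sqrt (\<gamma> i) else 0) =
      (if i = 0 then 0 else sqrt (\<gamma> i))"
    using assms(1) by (cases i) simp_all
  also have "(\<Sum>j\<in>{..<n} - {i}. if j = i + 1 then sqrt (\<gamma> (i + 1)) else 0) =
      (if i + 1 < n then sqrt (\<gamma> (i + 1)) else 0)"
    by simp
  finally show ?thesis .
qed

lemma gershgorin_union_zero_diagonal:
  assumes "\<And>i. i < dim_row A \<Longrightarrow> A $$ (i, i) = 0"
    and "\<And>i. i < dim_row A \<Longrightarrow> gershgorin_radius A i \<le> \<rho>"
    and "k < dim_row A" and "gershgorin_radius A k = \<rho>"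
  shows "gershgorin_union A = {- \<rho> .. \<rho>}"
proof
  show "gershgorin_union A \<subseteq> {- \<rho> .. \<rho>}"
    using assms(1,2) by (fastforce simp: gershgorin_union_def gershgorin_interval_def)
  have "gershgorin_interval A k = {- \<rho> .. \<rho>}"
    using assms(1,3,4) by (simp add: gershgorin_interval_def)
  then show "{- \<rho> .. \<rho>} \<subseteq> gershgorin_union A"
    using assms(3) by (auto simp: gershgorin_union_def)
qed

text \<open>The summands are the entries left and right of the diagonal, so with 0-based rows the
  perturbed entry enters rows \<open>r - 1\<close> and \<open>r\<close>.\<close>

definition dilated_radius :: "real \<Rightarrow> nat \<Rightarrow> nat \<Rightarrow> nat \<Rightarrow> real" where
  "dilated_radius lam r n i =
     (if i = 0 then 0 else if i = r then sqrt lam / 2 else 1 / 2) +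
     (if i + 1 < n then if i + 1 = r then sqrt lam / 2 else 1 / 2 else 0)"

lemma gershgorin_radius_dilated_jacobi:
  assumes "i < n" and "lam \<ge> 0"
  shows "gershgorin_radius (dilated_jacobi lam r n) i = dilated_radius lam r n i"
  unfolding dilated_jacobi_def using assms
  by (subst gershgorin_radius_jacobi)
    (auto simp: dilated_gamma_def dilated_radius_def real_sqrt_divide)

lemma gershgorin_dilated_eqI:
  assumes "lam \<ge> 0" and "\<And>i. i < n \<Longrightarrow> dilated_radius lam r n i \<le> \<rho>"
    and "k < n" and "dilated_radius lam r n k = \<rho>"
  shows "gershgorin_dilated n lam r = {- \<rho> .. \<rho>}"
proof -
  have dim: "dim_row (dilated_jacobi lam r n) = n"
    by (simp add: dilated_jacobi_def)
  show ?thesis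
    unfolding gershgorin_dilated_def
  proof (rule gershgorin_union_zero_diagonal)
    show "dilated_jacobi lam r n $$ (i, i) = 0" if "i < dim_row (dilated_jacobi lam r n)" for i
      using that unfolding dim by (simp add: dilated_jacobi_def jacobi_matrix_def)
  qed (use assms in \<open>auto simp: dim gershgorin_radius_dilated_jacobi\<close>)
qed

text \<open>Each of the two summands is at most 1/2; the row \<open>k\<close> is an inner one that
  misses the perturbed entry, so both equal 1/2 there.\<close>

lemma gershgorin_dilated_unit:
  assumes "0 \<le> lam" "lam \<le> 1" and k: "0 < k" "k + 1 < n" "k \<noteq> r" "k + 1 \<noteq> r"
  shows "gershgorin_dilated n lam r = {- 1 .. 1}"
proof (rule gershgorin_dilated_eqI)
  have "sqrt lam \<le> 1"
    using assms(2) by simp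
  then show "dilated_radius lam r n i \<le> 1" for i
    by (simp add: dilated_radius_def del: real_sqrt_le_1_iff)
  show "dilated_radius lam r n k = 1"
    using k by (simp add: dilated_radius_def)
qed (use assms in auto)

lemma gershgorin_dilated_large:
  assumes "1 \<le> lam" "1 \<le> r" "r < n" "3 \<le> n"
  shows "gershgorin_dilated n lam r = {- ((1 + sqrt lam) / 2) .. (1 + sqrt lam) / 2}"
proof (rule gershgorin_dilated_eqI)
  have "1 \<le> sqrt lam"
    using assms(1) by simp
  \<comment> \<open>The cases \<open>i = r\<close> and \<open>i + 1 = r\<close> exclude each other,
    so at most one summand is \<open>sqrt lam / 2\<close>.\<close>
  then show "dilated_radius lam r n i \<le> (1 + sqrt lam) / 2" for i
    by (simp add: dilated_radius_def add_divide_distrib del: real_sqrt_ge_1_iff real_sqrt_ge_0_iff)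
  \<comment> \<open>For \<open>r = 1\<close> row \<open>r - 1\<close> is the first row and has a
    single neighbour, so row \<open>r\<close> is taken instead; it is inner because \<open>n\<close>
    is at least 3.\<close>
  show "dilated_radius lam r n (if r = 1 then 1 else r - 1) = (1 + sqrt lam) / 2"
    using assms by (auto simp: dilated_radius_def)
qed (use assms in auto)

text \<open>Every inner row touches the perturbed entry, so no row has radius 1 from two unperturbed
  entries; row 1 attains the maximum in all three cases.\<close>

lemma gershgorin_dilated_small:
  assumes "0 \<le> lam" and "(r, n) \<in> {(1, 3), (2, 3), (2, 4)}"
  shows "gershgorin_dilated n lam r = {- ((1 + sqrt lam) / 2) .. (1 + sqrt lam) / 2}"
proof (rule gershgorin_dilated_eqI)
  show "dilated_radius lam r n i \<le> (1 + sqrt lam) / 2" if "i < n" for i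
  proof -
    have "0 \<le> sqrt lam"
      using assms(1) by simp
    moreover have "i \<in> {0, 1, 2, 3}"
      using that assms(2) by auto
    ultimately show ?thesis
      using that assms(2) by (auto simp: dilated_radius_def)
  qed
  show "dilated_radius lam r n 1 = (1 + sqrt lam) / 2"
    using assms(2) by (auto simp: dilated_radius_def add_divide_distrib)
qed (use assms in auto)

theorem proposition5p2:
  fixes r :: nat and lam :: real
  assumes "r \<ge> 1" and "lam > 0" and "lam \<noteq> 1"
  shows
    "(r = 1 \<longrightarrow>
        (lam > 0 \<longrightarrow>
           gershgorin_dilated 3 lam r = {- ((1 + sqrt lam) / 2) .. (1 + sqrt lam) / 2}) \<and>
        (0 < lam \<and> lam < 1 \<longrightarrow>
           (\<forall>n\<ge>4. gershgorin_dilated n lam r = {- 1 .. 1})) \<and>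
        (lam > 1 \<longrightarrow>
           (\<forall>n\<ge>4. gershgorin_dilated n lam r = {- ((1 + sqrt lam) / 2) .. (1 + sqrt lam) / 2})))
     \<and> (r = 2 \<longrightarrow>
        (lam > 0 \<longrightarrow>
           gershgorin_dilated 3 lam r = {- ((1 + sqrt lam) / 2) .. (1 + sqrt lam) / 2} \<and>
           gershgorin_dilated 4 lam r = {- ((1 + sqrt lam) / 2) .. (1 + sqrt lam) / 2}) \<and>
        (0 < lam \<and> lam < 1 \<longrightarrow>
           (\<forall>n\<ge>5. gershgorin_dilated n lam r = {- 1 .. 1})) \<and>
        (lam > 1 \<longrightarrow>
           (\<forall>n\<ge>5. gershgorin_dilated n lam r = {- ((1 + sqrt lam) / 2) .. (1 + sqrt lam) / 2})))
     \<and> (r \<ge> 3 \<longrightarrow>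
        (0 < lam \<and> lam < 1 \<longrightarrow>
           (\<forall>n\<ge>r + 1. gershgorin_dilated n lam r = {- 1 .. 1})) \<and>
        (lam > 1 \<longrightarrow>
           (\<forall>n\<ge>r + 1. gershgorin_dilated n lam r = {- ((1 + sqrt lam) / 2) .. (1 + sqrt lam) / 2})))"
proof -
  have unit: "gershgorin_dilated n lam r = {- 1 .. 1}"
    if "lam < 1" "r = 1 \<and> 4 \<le> n \<or> r = 2 \<and> 5 \<le> n \<or> 3 \<le> r \<and> r + 1 \<le> n" for n
    \<comment> \<open>The witness is the first inner row other than \<open>r - 1\<close> and
      \<open>r\<close>; that it is not the last row forces \<open>n\<close> to be at least 4 for
      \<open>r = 1\<close> and at least 5 for \<open>r = 2\<close>.\<close>
    using that assms gershgorin_dilated_unit[of lam "if r = 1 then 2 else if r = 2 then 3 else 1" n r]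
    by auto
  have large: "gershgorin_dilated n lam r = {- ((1 + sqrt lam) / 2) .. (1 + sqrt lam) / 2}"
    if "lam > 1" "r < n" "3 \<le> n" for n
    using gershgorin_dilated_large[of lam r n] that assms by simp
  have small: "gershgorin_dilated n lam r = {- ((1 + sqrt lam) / 2) .. (1 + sqrt lam) / 2}"
    if "(r, n) \<in> {(1, 3), (2, 3), (2, 4)}" for n
    using gershgorin_dilated_small[of lam r n] that assms by simp
  show ?thesis
    by (intro conjI impI allI; (rule small, simp; fail | rule large; simp; fail | rule unit; simp; fail))
qed

end
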